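(* Let $(\zeta_n)_{n\ge 1}$ be independent, identically distributed, rotationally invariant complex random variables with $\mathbb{E}|\zeta_n|^2=1$, let $(a_n)_{n\ge1}$ be a deterministic sequence of nonnegative real numbers, and let $F(z)=\sum_{n\ge1}\zeta_n a_n z^n$. Suppose that $\sum_{n\ge1} a_n^2<\infty$ and $\limsup_{n\to\infty} a_n^{1/n}=1$. If, almost surely, $F$ is unbounded on the open unit disk $\mathbb{D}$, then almost surely the image $F(\mathbb{D})$ is dense in $\mathbb{C}$.
   Context: A complex random variable $\zeta$ is rotationally invariant if $e^{i\theta}\zeta$ has the same law as $\zeta$ for every $\theta\in[0,2\pi]$. $\mathbb{D}=\{z\in\mathbb{C}:|z|<1\}$. Under the stated assumptions the power series $F$ almost surely has radius of convergence $1$, so it is almost surely an analytic function on $\mathbb{D}$. *)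

theory Defs
  imports "HOL-Probability.Probability"
begin

definition rotationally_invariant :: "'w measure \<Rightarrow> ('w \<Rightarrow> complex) \<Rightarrow> bool" where
  "rotationally_invariant M X \<longleftrightarrow>
     X \<in> borel_measurable M \<and>
     (\<forall>\<theta>\<in>{0..2 * pi}. distr M borel (\<lambda>\<omega>. exp (\<i> * of_real \<theta>) * X \<omega>) = distr M borel X)"

(* The series starts at index 1, hence the Suc; the values of \<zeta> and a at index 0 are irrelevant.
   The value is meaningful where the series converges; under the hypotheses of the theorem this
   is, almost surely, the case on the whole open unit disc. *)
definition random_power_series ::
    "(nat \<Rightarrow> 'w \<Rightarrow> complex) \<Rightarrow> (nat \<Rightarrow> real) \<Rightarrow> 'w \<Rightarrow> complex \<Rightarrow> complex" where
  "random_power_series \<zeta> a \<omega> z =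
     (\<Sum>n. \<zeta> (Suc n) \<omega> * of_real (a (Suc n)) * z ^ Suc n)"

end

theory Submission
  imports Defs
begin

text \<open>
  Split \<open>F = P + G\<close>, where \<open>P\<close> is the partial sum of the first \<open>N\<close> terms and \<open>G\<close> the tail, which is
  independent of \<open>P\<close>, small in mean square, and has the same law as \<open>v G\<close> for every unimodular
  constant \<open>v\<close>. By a zero-one law and rotation of the disc, \<open>G\<close> is almost surely unbounded near the
  boundary point \<open>1\<close>. If \<open>\<bar>P 1\<bar> \<le> K\<close>, then \<open>P\<close> is bounded by \<open>K + 1\<close> near \<open>1\<close>, where \<open>\<bar>G\<bar>\<close> takes both
  tiny and huge values, so that \<open>\<bar>G z\<bar> = \<bar>w - P z\<bar>\<close> for some \<open>z\<close> there. One of \<open>m = C K\<close> equidistributed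
  rotations \<open>v\<close> brings \<open>P z + v G z\<close> within \<open>r\<close> of \<open>w\<close>. Hence, given the first \<open>N\<close> coefficients, \<open>F\<close>
  hits the disc of radius \<open>r\<close> around \<open>w\<close> with probability at least \<open>1 / (2 m)\<close>. As \<open>\<bar>P 1\<bar> > K\<close> has
  probability \<open>O(1 / K\<^sup>2)\<close> uniformly in \<open>N\<close>, the probability \<open>p\<close> of missing that disc satisfies
  \<open>p \<le> (1 - 1 / (2 m)) p + O(1 / K\<^sup>2)\<close>, that is \<open>p = O(1 / K)\<close>, and \<open>p = 0\<close> on letting \<open>K\<close> tend to infinity.
\<close>

section \<open>Sequences of independent identically distributed variables\<close>

context sequence_space
begin

text \<open>Together with \<open>B \<in> sets S\<close>, this stands in for membership in the
  sigma-algebra generated by the first \<open>N\<close> coordinates.\<close>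

definition depends_on_first :: "nat \<Rightarrow> (nat \<Rightarrow> 'a) set \<Rightarrow> bool" where
  "depends_on_first N B \<longleftrightarrow>
     (\<forall>x\<in>space S. \<forall>y\<in>space S. (\<forall>i<N. x i = y i) \<longrightarrow> (x \<in> B \<longleftrightarrow> y \<in> B))"

lemma depends_on_first_mono: "depends_on_first N B \<Longrightarrow> N \<le> N' \<Longrightarrow> depends_on_first N' B"
  unfolding depends_on_first_def by (meson order_less_le_trans)

text \<open>The sets that can be so approximated form a sigma-algebra containing the one-coordinate
  cylinders that generate \<open>S\<close>.\<close>

lemma cylinder_approximation:
  assumes "E \<in> sets S" "0 < e"
  shows "\<exists>N B. B \<in> sets S \<and> depends_on_first N B \<and> prob ((E - B) \<union> (B - E)) < e"
proof -
  let ?R = "{{f \<in> \<Pi>\<^sub>E i\<in>UNIV. space M. f i \<in> A} | i A. i \<in> (UNIV::nat set) \<and> A \<in> sets M}"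
  have "E \<in> sigma_sets (\<Pi>\<^sub>E i\<in>UNIV. space M) ?R"
    using assms(1) by (simp add: sets_PiM_single)
  \<comment> \<open>The claim is quantified over all \<open>e\<close> because the union case needs a
    smaller tolerance for each of its sets.\<close>
  then have "E \<in> sets S \<and> (\<forall>e>0. \<exists>N B. B \<in> sets S \<and> depends_on_first N B \<and> prob ((E - B) \<union> (B - E)) < e)"
  proof induction
    case (Basic A)
    then obtain i C where A: "A = {f \<in> \<Pi>\<^sub>E i\<in>UNIV. space M. f i \<in> C}" "C \<in> sets M"
      by auto
    have "A \<in> sets S"
      unfolding A(1) space_PiM[symmetric] using A(2) by measurable
    moreover have "depends_on_first (Suc i) A"
      by (auto simp: depends_on_first_def A space_PiM)
    ultimately show ?case
      by (intro conjI allI impI exI[of _ "Suc i"] exI[of _ A]) auto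
  next
    case Empty
    show ?case
      by (intro conjI allI impI exI[of _ "0::nat"] exI[of _ "{}"]) (auto simp: depends_on_first_def)
  next
    case (Compl A)
    then have A: "A \<in> sets S" by simp
    show ?case
    proof (intro conjI allI impI)
      show "(\<Pi>\<^sub>E i\<in>UNIV. space M) - A \<in> sets S"
        unfolding space_PiM[symmetric] using A by auto
      fix e :: real assume "0 < e"
      then obtain N B where B: "B \<in> sets S" "depends_on_first N B" "prob ((A - B) \<union> (B - A)) < e"
        using Compl by blast
      have "sym_diff ((\<Pi>\<^sub>E i\<in>UNIV. space M) - A) (space S - B) = sym_diff A B"
        unfolding space_PiM[symmetric] using A B(1) sets.sets_into_space by blast
      then have "prob (sym_diff ((\<Pi>\<^sub>E i\<in>UNIV. space M) - A) (space S - B)) < e"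
        by (simp only: B(3))
      moreover have "depends_on_first N (space S - B)"
        using B(2) unfolding depends_on_first_def by blast
      moreover have "space S - B \<in> sets S" using B(1) by auto
      ultimately show "\<exists>N B. B \<in> sets S \<and> depends_on_first N B \<and>
          prob (sym_diff ((\<Pi>\<^sub>E i\<in>UNIV. space M) - A) B) < e"
        by blast
    qed
  next
    case (Union A)
    then have A: "\<And>i. A i \<in> sets S" by simp
    show ?case
    proof (intro conjI allI impI)
      show U: "(\<Union>i. A i) \<in> sets S" using A by auto
      fix e :: real assume e: "0 < e"
      have "(\<lambda>k. prob (\<Union>i<k. A i)) \<longlonglongrightarrow> prob (\<Union>k. \<Union>i<k. A i)"
        using A by (intro finite_Lim_measure_incseq) (auto simp: incseq_def intro: less_le_trans)
      moreover have UU: "(\<Union>k. \<Union>i<k. A i) = (\<Union>i. A i)" by auto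
      ultimately have "\<forall>\<^sub>F k in sequentially. prob (\<Union>i<k. A i) > prob (\<Union>i. A i) - e / 2"
        using e by (intro order_tendstoD(1)) auto
      then obtain k where k: "prob (\<Union>i<k. A i) > prob (\<Union>i. A i) - e / 2"
        by (auto simp: eventually_sequentially)
      \<comment> \<open>The \<open>k\<close> approximation errors add up to at most
        \<open>e / 2\<close>; truncating the union costs less than the other half. The
        \<open>+ 1\<close> covers \<open>k = 0\<close>.\<close>
      define d where "d = e / (2 * (real k + 1))"
      have d: "0 < d" using e by (simp add: d_def)
      have "\<forall>i. \<exists>N B. B \<in> sets S \<and> depends_on_first N B \<and> prob ((A i - B) \<union> (B - A i)) < d"
        using Union d by blast
      then obtain N B where B: "\<And>i. B i \<in> sets S" "\<And>i. depends_on_first (N i) (B i)"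
        "\<And>i. prob ((A i - B i) \<union> (B i - A i)) < d"
        by metis
      let ?C = "\<Union>i<k. B i"
      have C: "?C \<in> sets S" using B(1) by auto
      have "depends_on_first (Max (N ` {..k})) ?C"
      proof -
        have "depends_on_first (Max (N ` {..k})) (B i)" if "i < k" for i
          using that by (intro depends_on_first_mono[OF B(2)]) auto
        then show ?thesis
          unfolding depends_on_first_def by blast
      qed
      moreover have "prob (((\<Union>i. A i) - ?C) \<union> (?C - (\<Union>i. A i))) < e"
      proof -
        have "prob (((\<Union>i. A i) - ?C) \<union> (?C - (\<Union>i. A i)))
            \<le> prob (((\<Union>i. A i) - (\<Union>i<k. A i)) \<union> (\<Union>i<k. (A i - B i) \<union> (B i - A i)))"
          using A B(1) by (intro finite_measure_mono) auto
        also have "\<dots> \<le> prob ((\<Union>i. A i) - (\<Union>i<k. A i)) + prob (\<Union>i<k. (A i - B i) \<union> (B i - A i))"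
          using A B(1) by (intro measure_Un_le) auto
        also have "prob ((\<Union>i. A i) - (\<Union>i<k. A i)) = prob (\<Union>i. A i) - prob (\<Union>i<k. A i)"
          using A by (intro finite_measure_Diff) auto
        also have "\<dots> < e / 2" using k by simp
        also have "prob (\<Union>i<k. (A i - B i) \<union> (B i - A i)) \<le> (\<Sum>i<k. prob ((A i - B i) \<union> (B i - A i)))"
          using A B(1) by (intro measure_UNION_le) auto
        also have "\<dots> \<le> (\<Sum>i<k. d)"
          by (intro sum_mono less_imp_le B(3))
        also have "\<dots> \<le> e / 2"
          using e by (simp add: d_def field_simps)
        finally show ?thesis by simp
      qed
      ultimately show "\<exists>N B. B \<in> sets S \<and> depends_on_first N B \<and>
          prob (((\<Union>i. A i) - B) \<union> (B - (\<Union>i. A i))) < e"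
        using C by blast
    qed
  qed
  with assms(2) show ?thesis by blast
qed

text \<open>\<open>comb_seq N x y\<close> follows \<open>x\<close> before index \<open>N\<close> and
  then restarts with \<open>y\<close>. Its law under the product measure is \<open>S\<close>, so
  Fubini makes the integrand the conditional probability of \<open>E\<close> given the first
  \<open>N\<close> coordinates.\<close>

lemma emeasure_comb_seq:
  assumes "E \<in> sets S"
  shows "emeasure S E = (\<integral>\<^sup>+x. emeasure S {y \<in> space S. comb_seq N x y \<in> E} \<partial>S)"
proof -
  have "emeasure S E = emeasure (distr (S \<Otimes>\<^sub>M S) S (\<lambda>(x, y). comb_seq N x y)) E"
    by (simp only: PiM_comb_seq)
  also have "\<dots> = emeasure (S \<Otimes>\<^sub>M S) ((\<lambda>(x, y). comb_seq N x y) -` E \<inter> space (S \<Otimes>\<^sub>M S))"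
    using assms by (intro emeasure_distr measurable_comb_seq)
  also have "\<dots> = (\<integral>\<^sup>+x. emeasure S (Pair x -` ((\<lambda>(x, y). comb_seq N x y) -` E \<inter> space (S \<Otimes>\<^sub>M S))) \<partial>S)"
    using assms by (intro P.emeasure_pair_measure_alt measurable_sets[OF measurable_comb_seq])
  also have "\<dots> = (\<integral>\<^sup>+x. emeasure S {y \<in> space S. comb_seq N x y \<in> E} \<partial>S)"
    by (intro nn_integral_cong arg_cong[where f = "emeasure S"]) (auto simp: space_pair_measure)
  finally show ?thesis .
qed

lemma comb_seq_in_space: "x \<in> space S \<Longrightarrow> y \<in> space S \<Longrightarrow> comb_seq N x y \<in> space S"
  by (auto simp: space_PiM PiE_iff split: split_comb_seq)

text \<open>This takes the place of Levy's zero-one law.\<close>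

lemma prob_le_conditional_bound:
  assumes E: "E \<in> sets S"
    and X: "\<And>N. N \<ge> N0 \<Longrightarrow> X N \<in> sets S" "\<And>N. N \<ge> N0 \<Longrightarrow> prob (X N) \<le> \<eta>"
    and q: "0 \<le> q" "\<And>N x. N \<ge> N0 \<Longrightarrow> x \<in> space S - X N \<Longrightarrow> prob {y \<in> space S. comb_seq N x y \<in> E} \<le> q"
  shows "prob E \<le> q * prob E + \<eta>"
proof (rule field_le_epsilon)
  fix e :: real assume e: "0 < e"
  \<comment> \<open>The error \<open>d\<close> enters twice: once when \<open>E\<close> is replaced
    by \<open>E \<inter> B\<close>, and once, multiplied by \<open>q\<close>, when \<open>B\<close>
    is replaced by \<open>E\<close>.\<close>
  define d where "d = e / (q + 1)"
  have d: "0 < d" "q * d + d = e"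
    using e q(1) by (simp_all add: d_def add_divide_distrib[symmetric] distrib_left[symmetric]
        mult.commute nonzero_divide_eq_eq add_nonneg_eq_0_iff algebra_simps)
  obtain N' B where B: "B \<in> sets S" "depends_on_first N' B" "prob ((E - B) \<union> (B - E)) < d"
    using cylinder_approximation[OF E d(1)] by blast
  define N where "N = max N0 N'"
  have N: "N \<ge> N0" "depends_on_first N B"
    using B(2) depends_on_first_mono by (auto simp: N_def)
  have \<eta>: "0 \<le> \<eta>" using X(2)[OF N(1)] measure_nonneg order_trans by blast
  have "emeasure S (E \<inter> B) = (\<integral>\<^sup>+x. emeasure S {y \<in> space S. comb_seq N x y \<in> E \<inter> B} \<partial>S)"
    using E B(1) by (intro emeasure_comb_seq) auto
  \<comment> \<open>Since \<open>x\<close> alone decides \<open>B\<close>, the fibre is empty for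
    \<open>x\<close> outside \<open>B\<close>. Inside \<open>B\<close> the hypothesis gives
    \<open>q\<close>, except on \<open>X N\<close>, where the trivial bound 1 is used.\<close>
  also have "\<dots> \<le> (\<integral>\<^sup>+x. ennreal q * indicator B x + indicator (X N) x \<partial>S)"
  proof (intro nn_integral_mono)
    fix x assume x: "x \<in> space S"
    show "emeasure S {y \<in> space S. comb_seq N x y \<in> E \<inter> B} \<le> ennreal q * indicator B x + indicator (X N) x"
    proof (cases "x \<in> X N")
      case True
      have "emeasure S {y \<in> space S. comb_seq N x y \<in> E \<inter> B} \<le> 1" by (rule P.emeasure_le_1)
      then show ?thesis using True by (simp add: add_increasing)
    next
      case False
      have m: "{y \<in> space S. comb_seq N x y \<in> E} \<in> sets S"
        using x E by measurable
      have *: "comb_seq N x y \<in> B \<longleftrightarrow> x \<in> B" if "y \<in> space S" for y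
        using N(2) x that comb_seq_in_space[OF x that]
        unfolding depends_on_first_def by (metis comb_seq_less)
      show ?thesis
      proof (cases "x \<in> B")
        case True
        have "emeasure S {y \<in> space S. comb_seq N x y \<in> E \<inter> B} \<le> emeasure S {y \<in> space S. comb_seq N x y \<in> E}"
          using m by (intro emeasure_mono) auto
        also have "\<dots> \<le> ennreal q"
          using q(2)[OF N(1), of x] x False by (simp add: P.emeasure_eq_measure ennreal_leI)
        finally show ?thesis using True False by simp
      next
        case False
        then have "{y \<in> space S. comb_seq N x y \<in> E \<inter> B} = {}" using * by auto
        then show ?thesis by (simp only: emeasure_empty zero_le)
      qed
    qed
  qed
  also have "\<dots> = ennreal q * emeasure S B + emeasure S (X N)"
    using B(1) X(1)[OF N(1)] by (simp add: nn_integral_add nn_integral_cmult)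
  finally have "prob (E \<inter> B) \<le> q * prob B + prob (X N)"
    using q(1) by (simp add: P.emeasure_eq_measure ennreal_mult[symmetric] ennreal_plus[symmetric] del: ennreal_plus)
  moreover have "prob E \<le> prob (E \<inter> B) + prob ((E - B) \<union> (B - E))"
  proof -
    have "prob E \<le> prob ((E \<inter> B) \<union> ((E - B) \<union> (B - E)))"
      using E B(1) by (intro finite_measure_mono) auto
    also have "\<dots> \<le> prob (E \<inter> B) + prob ((E - B) \<union> (B - E))"
      using E B(1) by (intro measure_Un_le) auto
    finally show ?thesis .
  qed
  moreover have "prob B \<le> prob E + d"
  proof -
    have "prob B \<le> prob (E \<union> ((E - B) \<union> (B - E)))"
      using E B(1) by (intro finite_measure_mono) auto
    also have "\<dots> \<le> prob E + prob ((E - B) \<union> (B - E))"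
      using E B(1) by (intro measure_Un_le) auto
    finally show ?thesis using B(3) by simp
  qed
  then have "q * prob B \<le> q * prob E + q * d"
    using q(1) mult_left_mono[of "prob B" "prob E + d" q] by (simp add: distrib_left)
  ultimately show "prob E \<le> q * prob E + \<eta> + e"
    using X(2)[OF N(1)] B(3) d(2) by linarith
qed

text \<open>Product measures are determined by finite-dimensional cylinders, and the preimage of
  such a cylinder is again one, with factors of unchanged measure.\<close>

lemma distr_PiM_coordinatewise:
  assumes f: "\<And>i. f i \<in> measurable M M" "\<And>i. distr M M (f i) = M"
  shows "distr S S (\<lambda>x i. f i (x i)) = S"
proof (rule PiM_eq)
  have F [measurable]: "(\<lambda>x i. f i (x i)) \<in> measurable S S"
  proof (rule measurable_PiM_single')
    show "(\<lambda>x. f i (x i)) \<in> measurable S M" for i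
      using f(1) by (intro measurable_compose[OF measurable_component_singleton]) auto
    show "(\<lambda>x i. f i (x i)) \<in> space S \<rightarrow> (\<Pi>\<^sub>E i\<in>UNIV. space M)"
      using f(1) by (auto simp: space_PiM PiE_iff measurable_def Pi_iff)
  qed
  fix J A assume J: "finite J" "J \<subseteq> (UNIV::nat set)" "\<And>j. j \<in> J \<Longrightarrow> A j \<in> sets M"
  have A: "prod_emb UNIV (\<lambda>_. M) J (\<Pi>\<^sub>E j\<in>J. A j) \<in> sets S"
    using J by (intro sets_PiM_I) auto
  have "emeasure (distr S S (\<lambda>x i. f i (x i))) (prod_emb UNIV (\<lambda>_. M) J (\<Pi>\<^sub>E j\<in>J. A j))
      = emeasure S ((\<lambda>x i. f i (x i)) -` prod_emb UNIV (\<lambda>_. M) J (\<Pi>\<^sub>E j\<in>J. A j) \<inter> space S)"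
    by (rule emeasure_distr[OF F A])
  also have "(\<lambda>x i. f i (x i)) -` prod_emb UNIV (\<lambda>_. M) J (\<Pi>\<^sub>E j\<in>J. A j) \<inter> space S
      = prod_emb UNIV (\<lambda>_. M) J (\<Pi>\<^sub>E j\<in>J. f j -` A j \<inter> space M)"
    using f(1) by (auto simp: prod_emb_def space_PiM PiE_iff measurable_def Pi_iff)
  also have "emeasure S \<dots> = (\<Prod>j\<in>J. emeasure M (f j -` A j \<inter> space M))"
    using J f(1) by (intro emeasure_PiM_emb) (auto intro: measurable_sets)
  also have "\<dots> = (\<Prod>j\<in>J. emeasure M (A j))"
  proof (intro prod.cong refl)
    fix j assume j: "j \<in> J"
    have "emeasure M (f j -` A j \<inter> space M) = emeasure (distr M M (f j)) (A j)"
      by (rule emeasure_distr[OF f(1) J(3)[OF j], symmetric])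
    then show "emeasure M (f j -` A j \<inter> space M) = emeasure M (A j)"
      by (simp only: f(2))
  qed
  finally show "emeasure (distr S S (\<lambda>x i. f i (x i))) (prod_emb UNIV (\<lambda>_. M) J (\<Pi>\<^sub>E j\<in>J. A j))
      = (\<Prod>j\<in>J. emeasure M (A j))" .
qed simp_all

end

section \<open>Power series and their tails\<close>

text \<open>The sequence \<open>y\<close> is indexed from 0 while \<open>b\<close> and the exponent
  are shifted by \<open>N\<close>, so that \<open>y\<close> can be the second argument of
  \<open>comb_seq N\<close>. The full series is the case \<open>N = 0\<close>.\<close>

definition tail_series :: "(nat \<Rightarrow> real) \<Rightarrow> nat \<Rightarrow> (nat \<Rightarrow> complex) \<Rightarrow> complex \<Rightarrow> complex" where
  "tail_series b N y z = (\<Sum>n. y n * of_real (b (n + N)) * z ^ Suc (n + N))"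

definition partial_series :: "(nat \<Rightarrow> real) \<Rightarrow> nat \<Rightarrow> (nat \<Rightarrow> complex) \<Rightarrow> complex \<Rightarrow> complex" where
  "partial_series b N x z = (\<Sum>n<N. x n * of_real (b n) * z ^ Suc n)"

text \<open>A pathwise condition that gives convergence on the open unit disc, is preserved by
  rotations and by prepending a head, and holds almost surely.\<close>

definition bounded_coeffs :: "(nat \<Rightarrow> real) \<Rightarrow> nat \<Rightarrow> (nat \<Rightarrow> complex) \<Rightarrow> bool" where
  "bounded_coeffs b N y \<longleftrightarrow> bounded (range (\<lambda>n. y n * of_real (b (n + N))))"

lemma summable_powser_bounded:
  fixes c :: "nat \<Rightarrow> complex"
  assumes "bounded (range c)" "cmod z < 1"
  shows "summable (\<lambda>n. c n * z ^ n)"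
proof -
  obtain C where C: "\<And>n. cmod (c n) \<le> C"
    using assms(1) by (auto simp: bounded_iff)
  show ?thesis
  proof (rule summable_comparison_test')
    show "summable (\<lambda>n. C * cmod z ^ n)"
      using assms(2) by (intro summable_mult summable_geometric) simp
    show "norm (c n * z ^ n) \<le> C * cmod z ^ n" if "n \<ge> 0" for n
      using C[of n] by (simp add: norm_mult norm_power mult_right_mono)
  qed
qed

lemma
  assumes "bounded_coeffs b N y" "cmod z < 1"
  shows summable_tail_series: "summable (\<lambda>n. y n * of_real (b (n + N)) * z ^ Suc (n + N))"
    and tail_series_eq: "tail_series b N y z = z ^ Suc N * (\<Sum>n. y n * of_real (b (n + N)) * z ^ n)"
proof -
  have s: "summable (\<lambda>n. y n * of_real (b (n + N)) * z ^ n)"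
    using assms unfolding bounded_coeffs_def by (rule summable_powser_bounded)
  have eq: "y n * of_real (b (n + N)) * z ^ Suc (n + N) = z ^ Suc N * (y n * of_real (b (n + N)) * z ^ n)" for n
    by (simp add: power_add)
  show "summable (\<lambda>n. y n * of_real (b (n + N)) * z ^ Suc (n + N))"
    unfolding eq by (rule summable_mult[OF s])
  show "tail_series b N y z = z ^ Suc N * (\<Sum>n. y n * of_real (b (n + N)) * z ^ n)"
    unfolding tail_series_def eq by (rule suminf_mult[OF s])
qed

lemma continuous_on_tail_series:
  assumes "bounded_coeffs b N y"
  shows "continuous_on (ball 0 1) (tail_series b N y)"
proof -
  have "isCont (\<lambda>z. \<Sum>n. y n * of_real (b (n + N)) * z ^ n) z" if "z \<in> ball 0 1" for z
  proof -
    define k where "k = (1 + cmod z) / 2"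
    have k: "cmod z < k" "0 \<le> k" "k < 1" using that by (auto simp: k_def)
    have "summable (\<lambda>n. y n * of_real (b (n + N)) * (complex_of_real k) ^ n)"
      using assms k unfolding bounded_coeffs_def by (intro summable_powser_bounded) auto
    then show ?thesis
      by (rule isCont_powser) (use k in auto)
  qed
  then have "continuous_on (ball 0 1) (\<lambda>z. z ^ Suc N * (\<Sum>n. y n * of_real (b (n + N)) * z ^ n))"
    by (intro continuous_intros continuous_at_imp_continuous_on ballI) auto
  then show ?thesis
    by (rule continuous_on_eq) (use assms in \<open>auto simp: tail_series_eq\<close>)
qed

lemma continuous_on_partial_series: "continuous_on A (partial_series b N x)"
  unfolding partial_series_def by (intro continuous_intros)

lemma bounded_coeffs_comb_seq:
  assumes "bounded_coeffs b N y"
  shows "bounded_coeffs b 0 (comb_seq N x y)"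
proof -
  have "range (\<lambda>n. comb_seq N x y n * complex_of_real (b (n + 0)))
      \<subseteq> (\<lambda>n. x n * of_real (b n)) ` {..<N} \<union> range (\<lambda>n. y n * of_real (b (n + N)))"
  proof safe
    fix n assume "comb_seq N x y n * complex_of_real (b (n + 0)) \<notin> range (\<lambda>n. y n * of_real (b (n + N)))"
    moreover have "comb_seq N x y n * complex_of_real (b (n + 0)) \<in> range (\<lambda>n. y n * of_real (b (n + N)))" if "\<not> n < N"
      by (rule range_eqI[of _ _ "n - N"]) (use that in \<open>simp add: comb_seq_def\<close>)
    ultimately have "n < N" by blast
    then show "comb_seq N x y n * complex_of_real (b (n + 0)) \<in> (\<lambda>n. x n * of_real (b n)) ` {..<N}"
      by (auto simp: comb_seq_less)
  qed
  moreover have "bounded ((\<lambda>n. x n * complex_of_real (b n)) ` {..<N} \<union> range (\<lambda>n. y n * of_real (b (n + N))))"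
    using assms unfolding bounded_coeffs_def by (simp add: finite_imp_bounded)
  ultimately show ?thesis
    unfolding bounded_coeffs_def by (rule bounded_subset[rotated])
qed

text \<open>This is the decomposition of the series into the polynomial \<open>P\<close> and the
  tail \<open>G\<close>.\<close>

lemma tail_series_comb_seq:
  assumes "bounded_coeffs b N y" "cmod z < 1"
  shows "tail_series b 0 (comb_seq N x y) z = partial_series b N x z + tail_series b N y z"
proof -
  let ?t = "\<lambda>n. comb_seq N x y n * complex_of_real (b n) * z ^ Suc n"
  have "summable ?t"
    using summable_tail_series[OF bounded_coeffs_comb_seq[OF assms(1)] assms(2)] by simp
  then have "suminf ?t = (\<Sum>n. ?t (n + N)) + (\<Sum>n<N. ?t n)"
    by (rule suminf_split_initial_segment)
  then show ?thesis
    by (simp add: tail_series_def partial_series_def comb_seq_add comb_seq_less)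
qed

lemma tail_series_mult_left:
  assumes "bounded_coeffs b N y" "cmod z < 1"
  shows "tail_series b N (\<lambda>n. u * y n) z = u * tail_series b N y z"
  using suminf_mult[OF summable_tail_series[OF assms], of u]
  by (simp add: tail_series_def mult.assoc)

text \<open>The powers of \<open>u\<close> in the coefficients rotate the argument of the series,
  whereas the constant factor in \<open>tail_series_mult_left\<close> rotates its values. Both
  changes preserve the law of the coefficients.\<close>

lemma tail_series_rotate: "tail_series b 0 (\<lambda>n. u ^ Suc n * y n) z = tail_series b 0 y (u * z)"
  by (simp add: tail_series_def power_mult_distrib algebra_simps)

lemma bounded_coeffs_rotate:
  assumes "bounded_coeffs b N y" "\<And>n. cmod (u n) = 1"
  shows "bounded_coeffs b N (\<lambda>n. u n * y n)"
  using assms by (simp add: bounded_coeffs_def bounded_iff norm_mult)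

section \<open>Roots of unity and deterministic rotation arguments\<close>

text \<open>Round the argument of \<open>u\<close> down to a multiple of \<open>2 * pi / m\<close>;
  the chord is at most the arc.\<close>

lemma roots_of_unity_net:
  assumes "cmod u = 1" "0 < m"
  shows "\<exists>j<m. cmod (cis (2 * pi * real j / real m) - u) \<le> 2 * pi / real m"
proof -
  obtain t where t: "0 \<le> t" "t < 2 * pi" "u = cis t"
    using Arg2pi_eq[of u] Arg2pi_ge_0[of u] Arg2pi_lt_2pi[of u] assms(1) by (metis cis_conv_exp mult_1 of_real_1)
  define s where "s = real m * t / (2 * pi)"
  define j where "j = nat \<lfloor>s\<rfloor>"
  have s: "0 \<le> s" "s < real m" using t assms(2) by (auto simp: s_def field_simps)
  have j: "real j \<le> s" "s < real j + 1"
    using s(1) by (auto simp: j_def) 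
  have "real j < real m" using j(1) s(2) by linarith
  then have "j < m" by simp
  moreover have "cmod (cis (2 * pi * real j / real m) - u) \<le> 2 * pi / real m"
  proof -
    define h where "h = 2 * pi * real j / real m - t"
    have "cis (2 * pi * real j / real m) = cis t * cis h"
      by (simp add: h_def cis_mult)
    then have "cis (2 * pi * real j / real m) - u = cis t * (cis h - 1)"
      by (simp add: t(3) algebra_simps)
    then have "cmod (cis (2 * pi * real j / real m) - u) = cmod (cis h - 1)"
      by (simp add: norm_mult)
    also have "\<dots> = 2 * \<bar>sin (h / 2)\<bar>"
      using dist_exp_i_1[of h] by (simp add: dist_norm cis_conv_exp)
    also have "\<dots> \<le> \<bar>h\<bar>"
      using abs_sin_x_le_abs_x[of "h / 2"] by simp
    also have "h = 2 * pi / real m * (real j - s)"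
      using assms(2) by (simp add: h_def s_def field_simps)
    also have "\<bar>\<dots>\<bar> \<le> 2 * pi / real m * 1"
      unfolding abs_mult using j by (intro mult_mono) auto
    finally show ?thesis by simp
  qed
  ultimately show ?thesis by blast
qed

text \<open>Moves a witness of an open condition into the countable set \<open>D\<close>, over which
  the measurable events quantify.\<close>

lemma continuous_dense_witness:
  assumes "continuous_on U f" "open U" "open V" "z \<in> U" "f z \<in> V"
    and dense: "\<And>X. open X \<Longrightarrow> X \<noteq> {} \<Longrightarrow> \<exists>d\<in>D. d \<in> X"
  shows "\<exists>d\<in>D. d \<in> U \<and> f d \<in> V"
proof -
  have "open (f -` V \<inter> U)"
    using assms by (simp add: continuous_on_open_vimage)
  then show ?thesis using dense[of "f -` V \<inter> U"] assms(4,5) by auto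
qed

text \<open>By the intermediate value theorem \<open>\<bar>G\<bar>\<close> and
  \<open>\<bar>w - P\<bar>\<close> agree at some point of \<open>U\<close>, where a unimodular
  multiple of \<open>G\<close> carries \<open>P\<close> exactly to \<open>w\<close>. Passing to a
  nearby root of unity costs at most \<open>2 * pi / m\<close> times
  \<open>\<bar>w - P\<bar>\<close>, so the required \<open>m\<close> does not depend on the size of
  \<open>G\<close>.\<close>

lemma rotation_hits:
  assumes "continuous_on U P" "continuous_on U G" "connected U"
    and P: "\<And>z. z \<in> U \<Longrightarrow> cmod (P z) \<le> L"
    and z2: "z2 \<in> U" "cmod (G z2) < r / 4"
    and z1: "z1 \<in> U" "cmod (G z1) > L + cmod w"
    and m: "0 < m" "2 * pi * (L + cmod w) < r * real m"
  shows "\<exists>j<m. \<exists>z\<in>U. cmod (P z + cis (2 * pi * real j / real m) * G z - w) < r"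
proof -
  have r: "0 < r" using z2(2) norm_ge_zero[of "G z2"] by linarith
  show ?thesis
  \<comment> \<open>If \<open>P z2\<close> is already close to \<open>w\<close>, the small value
    \<open>G z2\<close> does no harm and \<open>j = 0\<close> works. Otherwise
    \<open>\<bar>G\<bar>\<close> is below \<open>\<bar>w - P\<bar>\<close> at \<open>z2\<close>, as
    the intermediate value theorem needs.\<close>
  proof (cases "cmod (P z2 - w) < r / 2")
    case True
    have "cmod (P z2 + G z2 - w) \<le> cmod (P z2 - w) + cmod (G z2)"
      using norm_triangle_ineq[of "P z2 - w" "G z2"] by (simp add: algebra_simps)
    then have "cmod (P z2 + G z2 - w) < r" using True z2(2) r by linarith
    then show ?thesis using z2(1) m(1) by (intro exI[of _ 0]) auto
  next
    case False
    define h where "h z = cmod (G z) - cmod (w - P z)" for z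
    have "connected (h ` U)"
      unfolding h_def using assms(1-3) by (intro connected_continuous_image continuous_intros)
    moreover have "h z2 \<le> 0"
      using False z2(2) r by (simp add: h_def norm_minus_commute)
    moreover have "0 \<le> h z1"
      using z1(2) P[OF z1(1)] norm_triangle_ineq4[of w "P z1"] by (simp add: h_def)
    ultimately have "0 \<in> h ` U"
      using z1(1) z2(1) by (blast intro: connectedD_interval)
    then obtain z where z: "z \<in> U" "cmod (G z) = cmod (w - P z)" by (auto simp: h_def)
    show ?thesis
    proof (cases "G z = 0")
      case True
      then show ?thesis using z r m(1) by (intro exI[of _ 0]) (auto intro!: bexI[of _ z])
    next
      case G: False
      define u where "u = (w - P z) / G z"
      have u: "cmod u = 1" "w - P z = u * G z"
        using z(2) G by (auto simp: u_def norm_divide)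
      obtain j where j: "j < m" "cmod (cis (2 * pi * real j / real m) - u) \<le> 2 * pi / real m"
        using roots_of_unity_net[OF u(1) m(1)] by blast
      have "P z + cis (2 * pi * real j / real m) * G z - w = (cis (2 * pi * real j / real m) - u) * G z"
        using u(2) by (simp add: algebra_simps)
      then have "cmod (P z + cis (2 * pi * real j / real m) * G z - w)
          = cmod (cis (2 * pi * real j / real m) - u) * cmod (w - P z)"
        by (simp add: norm_mult z(2))
      also have "\<dots> \<le> 2 * pi / real m * (L + cmod w)"
        using j(2) P[OF z(1)] norm_triangle_ineq4[of w "P z"] by (intro mult_mono) auto
      also have "\<dots> < r"
        using m by (simp add: field_simps)
      finally show ?thesis using j(1) z(1) by blast
    qed
  qed
qed

text \<open>The \<open>m\<close> rotated copies of the region near 1 cover an annulus along the unit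
  circle, and what remains lies in a compact disc inside the open one.\<close>

lemma bounded_by_rotations:
  assumes f: "continuous_on (ball 0 1) f" and \<rho>: "0 < \<rho>" and m: "0 < m" "2 * pi / real m < \<rho> / 2"
    and bd: "\<And>j. j < m \<Longrightarrow> \<exists>R. \<forall>z\<in>ball 0 1 \<inter> ball 1 \<rho>. cmod (f (cis (2 * pi * real j / real m) * z)) \<le> R"
  shows "\<exists>R. \<forall>z\<in>ball 0 1. cmod (f z) \<le> R"
proof -
  \<comment> \<open>For \<open>cmod z > d\<close> the radial distance to the circle and the distance
    to the nearest root are each below \<open>\<rho> / 2\<close>. The maximum with 0 ensures
    \<open>z \<noteq> 0\<close>, so that \<open>z\<close> has a direction.\<close>
  define d where "d = max 0 (1 - \<rho> / 2)"
  have d: "0 \<le> d" "d < 1" "1 - \<rho> / 2 \<le> d" using \<rho> by (auto simp: d_def)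
  have "bounded (f ` cball 0 d)"
    using d by (intro compact_imp_bounded compact_continuous_image continuous_on_subset[OF f] compact_cball) auto
  then obtain C where C: "\<And>z. cmod z \<le> d \<Longrightarrow> cmod (f z) \<le> C"
    by (force simp: bounded_iff)
  obtain R where R: "\<And>j z. j < m \<Longrightarrow> z \<in> ball 0 1 \<inter> ball 1 \<rho> \<Longrightarrow> cmod (f (cis (2 * pi * real j / real m) * z)) \<le> R j"
    using bd by metis
  have "cmod (f z) \<le> max C (Max (R ` {..<m}))" if z: "z \<in> ball 0 1" for z
  proof (cases "cmod z \<le> d")
    case True
    then show ?thesis using C[of z] by simp
  next
    case False
    define u where "u = sgn z"
    have z0: "z \<noteq> 0" using False d(1) by auto
    have u: "cmod u = 1" using z0 by (simp add: u_def norm_sgn)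
    have zu: "z = of_real (cmod z) * u" using z0 by (simp add: u_def sgn_eq)
    obtain j where j: "j < m" "cmod (cis (2 * pi * real j / real m) - u) \<le> 2 * pi / real m"
      using roots_of_unity_net[OF u m(1)] by blast
    let ?v = "cis (2 * pi * real j / real m)"
    have "cmod (z - u) = cmod (of_real (cmod z - 1) * u)"
      using zu by (metis left_diff_distrib mult_1 of_real_1 of_real_diff)
    also have "\<dots> = 1 - cmod z"
      unfolding norm_mult norm_of_real u using z by simp
    finally have zu': "cmod (z - u) = 1 - cmod z" .
    have "cmod (1 - z / ?v) = cmod ((?v - z) / ?v)"
      by (simp add: diff_divide_distrib)
    also have "\<dots> = cmod ((?v - u) - (z - u))"
      by (simp add: norm_divide)
    also have "\<dots> \<le> cmod (?v - u) + cmod (z - u)" by (rule norm_triangle_ineq4)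
    also have "\<dots> < \<rho>" using j(2) zu' m(2) False d(3) by linarith
    finally have "z / ?v \<in> ball 0 1 \<inter> ball 1 \<rho>"
      using z by (auto simp: dist_norm norm_divide)
    from R[OF j(1) this] have "cmod (f z) \<le> R j" by simp
    also have "R j \<le> Max (R ` {..<m})" using j(1) by (intro Max_ge) auto
    finally show ?thesis by simp
  qed
  then show ?thesis by blast
qed

lemma partial_series_bounded: "\<exists>C. \<forall>z\<in>ball 0 1. cmod (partial_series b N x z) \<le> C"
proof -
  have "bounded (partial_series b N x ` cball 0 1)"
    by (intro compact_imp_bounded compact_continuous_image continuous_on_partial_series compact_cball)
  then show ?thesis unfolding bounded_iff by (metis ball_subset_cball imageI subsetD)
qed

section \<open>Rotation-invariant coefficients\<close>

text \<open>The events below only look at \<open>z\<close> in the countable dense set \<open>D\<close>, which makes them measurable.\<close>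

locale rotation_invariant_sequence = sequence_space M for M :: "complex measure" +
  fixes b :: "nat \<Rightarrow> real" and D :: "complex set"
  assumes sets_M [measurable_cong, simp]: "sets M = sets borel"
    and distr_rotate: "cmod u = 1 \<Longrightarrow> distr M M ((*) u) = M"
    and second_moment: "(\<integral>\<^sup>+x. ennreal ((cmod x)\<^sup>2) \<partial>M) = 1"
    and summable_b: "summable (\<lambda>n. (b n)\<^sup>2)"
    and countable_D [simp, intro]: "countable D"
    and dense_D: "open X \<Longrightarrow> X \<noteq> {} \<Longrightarrow> \<exists>d\<in>D. d \<in> X"
begin

abbreviation "F \<equiv> tail_series b 0"

lemma space_M [simp]: "space M = UNIV"
  using sets_eq_imp_space_eq[OF sets_M] by simp

lemma space_S [simp]: "space S = UNIV"
  by (simp add: space_PiM)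

lemma second_moment_coordinate: "(\<integral>\<^sup>+y. ennreal ((cmod (y n))\<^sup>2) \<partial>S) = 1"
proof -
  have meas: "(\<lambda>x. ennreal ((cmod x)\<^sup>2)) \<in> borel_measurable M" by measurable
  have "1 = (\<integral>\<^sup>+x. ennreal ((cmod x)\<^sup>2) \<partial>distr S M (\<lambda>y. y n))"
    using PiM_component[of n] second_moment by simp
  also have "\<dots> = (\<integral>\<^sup>+y. ennreal ((cmod (y n))\<^sup>2) \<partial>S)"
    by (rule nn_integral_distr) (use meas in auto)
  finally show ?thesis by simp
qed

lemma measurable_coordinate [measurable]: "(\<lambda>y. y n) \<in> borel_measurable S"
proof -
  have "(\<lambda>y. y n) \<in> measurable S M" by measurable
  also have "measurable S M = borel_measurable S" by (intro measurable_cong_sets) auto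
  finally show ?thesis .
qed

lemma measurable_tail_series [measurable]: "(\<lambda>y. tail_series b N y z) \<in> borel_measurable S"
  unfolding tail_series_def suminf_eq_lim by measurable

lemma measurable_partial_series [measurable]: "(\<lambda>y. partial_series b N y z) \<in> borel_measurable S"
  unfolding partial_series_def by measurable

lemma distr_rotate_S:
  assumes "\<And>n. cmod (u n) = 1"
  shows "distr S S (\<lambda>y n. u n * y n) = S"
proof (rule distr_PiM_coordinatewise)
  fix i
  have "(*) (u i) \<in> borel_measurable borel" by measurable
  also have "borel_measurable borel = measurable M M" by (intro measurable_cong_sets) auto
  finally show "(*) (u i) \<in> measurable M M" .
qed (use assms distr_rotate in auto)

lemma measurable_rotate: "(\<lambda>y n. u n * y n) \<in> measurable S S"
proof (rule measurable_PiM_single')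
  have "(\<lambda>y. u i * y i) \<in> borel_measurable S" for i by measurable
  also have "borel_measurable S = measurable S M" by (intro measurable_cong_sets) auto
  finally show "(\<lambda>y. u i * y i) \<in> measurable S M" for i .
qed simp

lemma prob_rotate:
  assumes "\<And>n. cmod (u n) = 1" "A \<in> sets S"
  shows "prob {y. (\<lambda>n. u n * y n) \<in> A} = prob A"
proof -
  have "prob A = measure (distr S S (\<lambda>y n. u n * y n)) A"
    by (simp only: distr_rotate_S[OF assms(1)])
  also have "\<dots> = prob ((\<lambda>y n. u n * y n) -` A \<inter> space S)"
    by (rule measure_distr[OF measurable_rotate assms(2)])
  finally show ?thesis by (simp add: vimage_def)
qed

lemma AE_rotate:
  assumes "\<And>n. cmod (u n) = 1" "AE y in S. Q y"
  shows "AE y in S. Q (\<lambda>n. u n * y n)"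
  by (rule AE_distrD[OF measurable_rotate]) (simp only: distr_rotate_S[OF assms(1)] assms(2))

section \<open>Second moments of the random series\<close>

text \<open>Flipping the sign of the last coefficient preserves the law, so the parallelogram
  identity removes the cross term within nonnegative integrals.\<close>

lemma second_moment_sum:
  "(\<integral>\<^sup>+y. ennreal ((cmod (\<Sum>n<k. y n * c n))\<^sup>2) \<partial>S) = ennreal (\<Sum>n<k. (cmod (c n))\<^sup>2)"
proof (induction k)
  case 0
  then show ?case by simp
next
  case (Suc k)
  define A where "A y = (\<Sum>n<k. y n * c n)" for y :: "nat \<Rightarrow> complex"
  define B where "B y = y k * c k" for y :: "nat \<Rightarrow> complex"
  have [measurable]: "A \<in> borel_measurable S" "B \<in> borel_measurable S"
    unfolding A_def B_def by measurable
  define u where "u n = (if n = k then - 1 else 1 :: complex)" for n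
  have flip: "A (\<lambda>n. u n * y n) = A y" "B (\<lambda>n. u n * y n) = - B y" for y
    by (auto simp: A_def B_def u_def intro!: sum.cong)
  let ?I = "\<integral>\<^sup>+y. ennreal ((cmod (A y + B y))\<^sup>2) \<partial>S"
  have "?I = (\<integral>\<^sup>+y. ennreal ((cmod (A y + B y))\<^sup>2) \<partial>distr S S (\<lambda>y n. u n * y n))"
    by (subst distr_rotate_S) (auto simp: u_def)
  also have "\<dots> = (\<integral>\<^sup>+y. ennreal ((cmod (A y - B y))\<^sup>2) \<partial>S)"
    by (subst nn_integral_distr[OF measurable_rotate]) (auto simp: flip)
  finally have "?I + ?I = (\<integral>\<^sup>+y. ennreal ((cmod (A y + B y))\<^sup>2) + ennreal ((cmod (A y - B y))\<^sup>2) \<partial>S)"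
    by (subst nn_integral_add) auto
  also have "\<dots> = (\<integral>\<^sup>+y. 2 * (ennreal ((cmod (A y))\<^sup>2) + ennreal ((cmod (c k))\<^sup>2) * ennreal ((cmod (y k))\<^sup>2)) \<partial>S)"
  proof (intro nn_integral_cong)
    fix y :: "nat \<Rightarrow> complex"
    have "(cmod (A y + B y))\<^sup>2 + (cmod (A y - B y))\<^sup>2 = 2 * ((cmod (A y))\<^sup>2 + (cmod (B y))\<^sup>2)"
      unfolding cmod_power2 by (simp add: power2_eq_square algebra_simps)
    also have "cmod (B y) = cmod (c k) * cmod (y k)" by (simp add: B_def norm_mult)
    finally show "ennreal ((cmod (A y + B y))\<^sup>2) + ennreal ((cmod (A y - B y))\<^sup>2)
        = 2 * (ennreal ((cmod (A y))\<^sup>2) + ennreal ((cmod (c k))\<^sup>2) * ennreal ((cmod (y k))\<^sup>2))"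
      by (simp add: ennreal_mult[symmetric] ennreal_plus[symmetric] power_mult_distrib
          ennreal_numeral[symmetric] del: ennreal_plus ennreal_numeral)
  qed
  also have "\<dots> = 2 * (ennreal (\<Sum>n<k. (cmod (c n))\<^sup>2) + ennreal ((cmod (c k))\<^sup>2))"
    using Suc.IH by (simp add: nn_integral_cmult nn_integral_add second_moment_coordinate A_def)
  also have "\<dots> = 2 * ennreal (\<Sum>n<Suc k. (cmod (c n))\<^sup>2)"
    by (simp add: sum_nonneg)
  finally have "2 * ?I = 2 * ennreal (\<Sum>n<Suc k. (cmod (c n))\<^sup>2)"
    by (simp only: mult_2)
  then have "?I = ennreal (\<Sum>n<Suc k. (cmod (c n))\<^sup>2)"
    by (subst (asm) ennreal_mult_cancel_left) auto
  then show ?case by (simp add: A_def B_def)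
qed

text \<open>The squared moduli of the coefficients have a finite expected sum, so almost surely they
  are summable and hence bounded.\<close>

lemma AE_bounded_coeffs: "AE y in S. bounded_coeffs b N y"
proof -
  have s: "summable (\<lambda>n. (b (n + N))\<^sup>2)" using summable_b by (rule summable_ignore_initial_segment)
  have "(\<integral>\<^sup>+y. (\<Sum>n. ennreal ((cmod (y n * of_real (b (n + N))))\<^sup>2)) \<partial>S)
      = (\<Sum>n. \<integral>\<^sup>+y. ennreal ((b (n + N))\<^sup>2) * ennreal ((cmod (y n))\<^sup>2) \<partial>S)"
    by (subst nn_integral_suminf)
      (auto simp: norm_mult power_mult_distrib ennreal_mult[symmetric] mult.commute)
  also have "\<dots> = (\<Sum>n. ennreal ((b (n + N))\<^sup>2))"
    by (simp add: nn_integral_cmult second_moment_coordinate)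
  also have "\<dots> \<noteq> \<infinity>"
    using s by (simp add: suminf_ennreal2)
  finally have "AE y in S. (\<Sum>n. ennreal ((cmod (y n * of_real (b (n + N))))\<^sup>2)) \<noteq> \<infinity>"
    by (intro nn_integral_PInf_AE) auto
  then show ?thesis
  proof eventually_elim
    case (elim y)
    have "summable (\<lambda>n. (cmod (y n * of_real (b (n + N))))\<^sup>2)"
      by (rule summable_suminf_not_top) (use elim in auto)
    then have "bounded (range (\<lambda>n. (cmod (y n * of_real (b (n + N))))\<^sup>2))"
      by (rule summable_imp_bounded)
    then obtain C where C: "\<And>n. (cmod (y n * of_real (b (n + N))))\<^sup>2 \<le> C"
      by (auto simp: bounded_iff)
    then have "cmod (y n * of_real (b (n + N))) \<le> sqrt C" for n
      by (simp add: real_le_rsqrt)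
    then show ?case unfolding bounded_coeffs_def bounded_iff by blast
  qed
qed

text \<open>Fatou's lemma applied to the partial sums, whose second moments are known exactly; the
  powers of \<open>z\<close> have modulus at most 1.\<close>

lemma second_moment_tail_series:
  assumes z: "cmod z < 1"
  shows "(\<integral>\<^sup>+y. ennreal ((cmod (tail_series b N y z))\<^sup>2) \<partial>S) \<le> ennreal (\<Sum>n. (b (n + N))\<^sup>2)"
proof -
  define c where "c n = complex_of_real (b (n + N)) * z ^ Suc (n + N)" for n
  have s: "summable (\<lambda>n. (b (n + N))\<^sup>2)" using summable_b by (rule summable_ignore_initial_segment)
  have "(\<integral>\<^sup>+y. ennreal ((cmod (tail_series b N y z))\<^sup>2) \<partial>S)
      = (\<integral>\<^sup>+y. liminf (\<lambda>k. ennreal ((cmod (\<Sum>n<k. y n * c n))\<^sup>2)) \<partial>S)"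
  proof (intro nn_integral_cong_AE, use AE_bounded_coeffs[of N] in eventually_elim)
    case (elim y)
    have "(\<lambda>k. \<Sum>n<k. y n * c n) \<longlonglongrightarrow> tail_series b N y z"
      using summable_LIMSEQ[OF summable_tail_series[OF elim z]]
      by (simp add: tail_series_def c_def mult.assoc)
    then have "(\<lambda>k. ennreal ((cmod (\<Sum>n<k. y n * c n))\<^sup>2)) \<longlonglongrightarrow> ennreal ((cmod (tail_series b N y z))\<^sup>2)"
      by (intro tendsto_ennrealI tendsto_intros)
    then show ?case by (intro lim_imp_Liminf[symmetric]) auto
  qed
  also have "\<dots> \<le> liminf (\<lambda>k. \<integral>\<^sup>+y. ennreal ((cmod (\<Sum>n<k. y n * c n))\<^sup>2) \<partial>S)"
    by (intro nn_integral_liminf) measurable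
  also have "\<dots> \<le> liminf (\<lambda>k::nat. ennreal (\<Sum>n. (b (n + N))\<^sup>2))"
  proof (intro Liminf_mono always_eventually allI)
    fix k
    have "(\<Sum>n<k. (cmod (c n))\<^sup>2) \<le> (\<Sum>n<k. (b (n + N))\<^sup>2)"
    proof (rule sum_mono)
      fix n
      have "cmod z ^ Suc (n + N) \<le> 1" using z by (intro power_le_one) auto
      then have "cmod (c n) \<le> \<bar>b (n + N)\<bar> * 1"
        unfolding c_def norm_mult norm_power norm_of_real by (intro mult_left_mono) auto
      then show "(cmod (c n))\<^sup>2 \<le> (b (n + N))\<^sup>2"
        using power_mono[of "cmod (c n)" "\<bar>b (n + N)\<bar>" 2] by simp
    qed
    also have "\<dots> \<le> (\<Sum>n. (b (n + N))\<^sup>2)" by (intro sum_le_suminf s) auto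
    finally show "(\<integral>\<^sup>+y. ennreal ((cmod (\<Sum>n<k. y n * c n))\<^sup>2) \<partial>S) \<le> ennreal (\<Sum>n. (b (n + N))\<^sup>2)"
      by (simp only: second_moment_sum ennreal_leI)
  qed
  also have "\<dots> = ennreal (\<Sum>n. (b (n + N))\<^sup>2)" by (simp add: Liminf_const)
  finally show ?thesis .
qed

lemma chebyshev:
  fixes X :: "(nat \<Rightarrow> complex) \<Rightarrow> complex"
  assumes [measurable]: "X \<in> borel_measurable S"
    and "(\<integral>\<^sup>+y. ennreal ((cmod (X y))\<^sup>2) \<partial>S) \<le> ennreal v" "0 < t" "0 \<le> v"
  shows "prob {y. t \<le> cmod (X y)} \<le> v / t\<^sup>2"
proof -
  have "emeasure S {y\<in>UNIV. 1 \<le> ennreal (1 / t\<^sup>2) * ennreal ((cmod (X y))\<^sup>2)}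
      \<le> ennreal (1 / t\<^sup>2) * (\<integral>\<^sup>+y. ennreal ((cmod (X y))\<^sup>2) * indicator UNIV y \<partial>S)"
    using sets.top[of S] by (intro nn_integral_Markov_inequality) auto
  also have "\<dots> \<le> ennreal (1 / t\<^sup>2) * ennreal v"
    using assms(2) by (intro mult_left_mono) auto
  also have "\<dots> = ennreal (v / t\<^sup>2)" using assms(4) by (simp add: ennreal_mult[symmetric])
  also have "{y\<in>UNIV. 1 \<le> ennreal (1 / t\<^sup>2) * ennreal ((cmod (X y))\<^sup>2)} = {y. t \<le> cmod (X y)}"
    using assms(3) power2_le_iff_abs_le[of t]
    by (auto simp: ennreal_mult[symmetric] field_simps abs_le_square_iff[symmetric] simp flip: ennreal_1)
  finally show ?thesis using assms(4) by (simp add: P.emeasure_eq_measure)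
qed

section \<open>Zero-one law for unboundedness near the boundary point 1\<close>

definition unbounded_near :: "real \<Rightarrow> (nat \<Rightarrow> complex) set" where
  "unbounded_near \<rho> = {y. \<forall>R::nat. \<exists>z\<in>D. z \<in> ball 0 1 \<inter> ball 1 \<rho> \<and> real R < cmod (F y z)}"

definition hits :: "complex \<Rightarrow> real \<Rightarrow> (nat \<Rightarrow> complex) set" where
  "hits w r = {y. \<exists>z\<in>D. z \<in> ball 0 1 \<and> cmod (F y z - w) < r}"

lemma sets_unbounded_near [measurable]: "unbounded_near \<rho> \<in> sets S"
proof -
  have "{y \<in> space S. \<forall>R::nat. \<exists>z\<in>D. z \<in> ball 0 1 \<inter> ball 1 \<rho> \<and> real R < cmod (F y z)} \<in> sets S"
    by measurable
  then show ?thesis by (simp add: unbounded_near_def)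
qed

lemma sets_hits [measurable]: "hits w r \<in> sets S"
proof -
  have "{y \<in> space S. \<exists>z\<in>D. z \<in> ball 0 1 \<and> cmod (F y z - w) < r} \<in> sets S"
    by measurable
  then show ?thesis by (simp add: hits_def)
qed

lemma sets_comb_seq: "A \<in> sets S \<Longrightarrow> {y. comb_seq N x y \<in> A} \<in> sets S"
proof -
  assume [measurable]: "A \<in> sets S"
  have "{y \<in> space S. comb_seq N x y \<in> A} \<in> sets S"
    by (rule measurable_sets_Collect[where N = S]) measurable
  then show ?thesis by simp
qed

text \<open>Changing the head changes the series by a difference of two polynomials, which is
  bounded on the disc.\<close>

lemma unbounded_near_comb_seq_cong:
  assumes y: "bounded_coeffs b N y" and unb: "comb_seq N x y \<in> unbounded_near \<rho>"
  shows "comb_seq N x' y \<in> unbounded_near \<rho>"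
  unfolding unbounded_near_def
proof (intro CollectI allI)
  fix R :: nat
  obtain C where C: "\<And>z. z \<in> ball 0 1 \<Longrightarrow> cmod (partial_series b N x z) \<le> C"
    using partial_series_bounded by blast
  obtain C' where C': "\<And>z. z \<in> ball 0 1 \<Longrightarrow> cmod (partial_series b N x' z) \<le> C'"
    using partial_series_bounded by blast
  obtain Q :: nat where Q: "real R + C + C' \<le> real Q" using real_arch_simple by blast
  obtain z where z: "z \<in> D" "z \<in> ball 0 1 \<inter> ball 1 \<rho>" "real Q < cmod (F (comb_seq N x y) z)"
    using unb unfolding unbounded_near_def by blast
  have "F (comb_seq N x y) z = F (comb_seq N x' y) z + partial_series b N x z - partial_series b N x' z"
    using z(2) by (simp add: tail_series_comb_seq[OF y])
  then have "cmod (F (comb_seq N x y) z)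
      \<le> cmod (F (comb_seq N x' y) z) + cmod (partial_series b N x z) + cmod (partial_series b N x' z)"
    by (metis norm_triangle_ineq norm_triangle_ineq4 add_right_mono order_trans)
  then have "real R < cmod (F (comb_seq N x' y) z)"
    using C[of z] C'[of z] z(2,3) Q by auto
  then show "\<exists>z\<in>D. z \<in> ball 0 1 \<inter> ball 1 \<rho> \<and> real R < cmod (F (comb_seq N x' y) z)"
    using z by blast
qed

text \<open>The conditional probability given the head does not depend on the head, so it equals its
  own average.\<close>

lemma prob_unbounded_near_comb_seq:
  "prob {y. comb_seq N x y \<in> unbounded_near \<rho>} = prob (unbounded_near \<rho>)"
proof -
  have eq: "emeasure S {y. comb_seq N x' y \<in> unbounded_near \<rho>} = emeasure S {y. comb_seq N x y \<in> unbounded_near \<rho>}" for x'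
    using AE_bounded_coeffs[of N]
    by (intro emeasure_eq_AE sets_comb_seq sets_unbounded_near)
      (auto elim!: eventually_mono intro: unbounded_near_comb_seq_cong)
  have "emeasure S (unbounded_near \<rho>) = (\<integral>\<^sup>+x'. emeasure S {y. comb_seq N x' y \<in> unbounded_near \<rho>} \<partial>S)"
    using emeasure_comb_seq[OF sets_unbounded_near, of \<rho> N] by simp
  also have "\<dots> = (\<integral>\<^sup>+x'. emeasure S {y. comb_seq N x y \<in> unbounded_near \<rho>} \<partial>S)"
    by (intro nn_integral_cong eq)
  also have "\<dots> = emeasure S {y. comb_seq N x y \<in> unbounded_near \<rho>}"
    using P.emeasure_space_1 by simp
  finally show ?thesis by (simp add: measure_def)
qed

text \<open>The probability is 0 or 1. If it were 0, invariance under rotation of the disc would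
  make the series bounded near every root of unity of a fine net, hence on the whole disc.\<close>

lemma prob_unbounded_near:
  assumes unb: "AE y in S. \<forall>R::nat. \<exists>z\<in>D. z \<in> ball 0 1 \<and> real R < cmod (F y z)"
    and \<rho>: "0 < \<rho>"
  shows "prob (unbounded_near \<rho>) = 1"
proof (rule ccontr)
  let ?p = "prob (unbounded_near \<rho>)"
  assume "?p \<noteq> 1"
  then have "?p < 1" using P.prob_le_1[of "unbounded_near \<rho>"] by linarith
  \<comment> \<open>Every conditional probability equals \<open>?p\<close>, so the conditional bound
    applies with \<open>q = ?p\<close> and no exceptional set.\<close>
  have "?p \<le> ?p * ?p + 0"
    by (rule prob_le_conditional_bound[where X = "\<lambda>_. {}" and ?N0.0 = 0])
      (auto simp: prob_unbounded_near_comb_seq)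
  then have "?p * (1 - ?p) \<le> 0" by (simp add: algebra_simps)
  then have "?p = 0"
    using \<open>?p < 1\<close> measure_nonneg[of S "unbounded_near \<rho>"] by (simp add: mult_le_0_iff)
  then have null: "AE y in S. y \<notin> unbounded_near \<rho>"
    by (intro AE_I[of _ _ "unbounded_near \<rho>"]) (auto simp: P.emeasure_eq_measure)
  obtain m :: nat where m: "4 * pi / \<rho> < real m" using reals_Archimedean2 by blast
  then have m0: "0 < m" using \<rho> by (cases m) (auto simp: divide_less_0_iff)
  have m2: "2 * pi / real m < \<rho> / 2" using m m0 \<rho> by (simp add: field_simps)
  define v where "v j = cis (2 * pi * real j / real m)" for j
  have "AE y in S. (\<lambda>n. v j ^ Suc n * y n) \<notin> unbounded_near \<rho>" for j
    by (rule AE_rotate[OF _ null]) (simp add: v_def norm_power norm_mult)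
  then have "AE y in S. \<forall>j\<in>{..<m}. (\<lambda>n. v j ^ Suc n * y n) \<notin> unbounded_near \<rho>"
    by (intro AE_finite_allI) auto
  with AE_bounded_coeffs[of 0] unb have "AE y in S. False"
  proof eventually_elim
    case (elim y)
    have cont: "continuous_on (ball 0 1) (F y)" by (rule continuous_on_tail_series[OF elim(1)])
    have "\<exists>R. \<forall>z\<in>ball 0 1 \<inter> ball 1 \<rho>. cmod (F y (v j * z)) \<le> R" if "j < m" for j
    proof -
      let ?y = "\<lambda>n. v j ^ Suc n * y n"
      have "?y \<notin> unbounded_near \<rho>" using elim(3) that by blast
      then obtain R :: nat where R: "\<And>z. z \<in> D \<Longrightarrow> z \<in> ball 0 1 \<inter> ball 1 \<rho> \<Longrightarrow> cmod (F ?y z) \<le> real R"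
        unfolding unbounded_near_def mem_Collect_eq by (meson not_less)
      have cont': "continuous_on (ball 0 1) (F ?y)"
        by (intro continuous_on_tail_series bounded_coeffs_rotate[OF elim(1)]) (simp add: v_def norm_power norm_mult)
      \<comment> \<open>The bound is known on \<open>D\<close> only; continuity extends it to the
        whole region.\<close>
      have "cmod (F ?y z) \<le> real R" if z: "z \<in> ball 0 1 \<inter> ball 1 \<rho>" for z
      proof (rule ccontr)
        assume "\<not> ?thesis"
        then have "\<exists>d\<in>D. d \<in> ball 0 1 \<inter> ball 1 \<rho> \<and> F ?y d \<in> - cball 0 (real R)"
          using z by (intro continuous_dense_witness[where z = z] continuous_on_subset[OF cont'] dense_D) auto
        then show False using R by fastforce
      qed
      then show ?thesis unfolding tail_series_rotate by blast
    qed
    then obtain R where R: "\<And>z. z \<in> ball 0 1 \<Longrightarrow> cmod (F y z) \<le> R"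
      using bounded_by_rotations[OF cont \<rho> m0 m2] unfolding v_def by blast
    obtain Q :: nat where "R \<le> real Q" using real_arch_simple by blast
    then show False using elim(2) R by (meson not_less order_trans)
  qed
  then show False by simp
qed

section \<open>Hitting a given disc\<close>

text \<open>With probability at least 1/2 the tail is small at a chosen point near 1, and then one
  of \<open>m\<close> rotations of the tail produces a hit. These \<open>m\<close> events are
  equally likely, so the union bound applies. The result depends on the head only through
  \<open>K\<close>.\<close>

lemma prob_hits_comb_seq:
  assumes unb: "AE y in S. \<forall>R::nat. \<exists>z\<in>D. z \<in> ball 0 1 \<and> real R < cmod (F y z)"
    and r: "0 < r" and small: "(\<Sum>n. (b (n + N))\<^sup>2) \<le> r\<^sup>2 / 32"
    and K: "cmod (partial_series b N x 1) \<le> K"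
    and m: "0 < m" "2 * pi * (K + 1 + cmod w) < r * real m"
  shows "1 / (2 * real m) \<le> prob {y. comb_seq N x y \<in> hits w r}"
proof -
  let ?P = "partial_series b N x" and ?G = "tail_series b N"
  define v where "v j = cis (2 * pi * real j / real m)" for j
  have "isCont ?P 1"
    using continuous_on_partial_series[of UNIV] by (simp add: continuous_on_eq_continuous_at)
  then obtain \<rho> where \<rho>: "0 < \<rho>" "\<And>z. dist z 1 < \<rho> \<Longrightarrow> dist (?P z) (?P 1) < 1"
    unfolding continuous_at_eps_delta by (metis zero_less_one)
  define U where "U = ball 0 1 \<inter> ball (1::complex) \<rho>"
  have U: "open U" "connected U" "U \<subseteq> ball 0 1"
    by (auto simp: U_def intro!: convex_connected convex_Int)
  have PU: "cmod (?P z) \<le> K + 1" if "z \<in> U" for z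
  proof -
    have "dist (?P z) (?P 1) < 1" using that by (intro \<rho>(2)) (auto simp: U_def dist_commute)
    then show ?thesis using K norm_triangle_sub[of "?P z" "?P 1"] by (simp add: dist_norm)
  qed
  \<comment> \<open>A real point inside the disc and within \<open>\<rho>\<close> of 1, at which the
    tail will be small.\<close>
  define t where "t = 1 - min \<rho> 1 / 2"
  have t: "0 < t" "t < 1" "1 - t < \<rho>" using \<rho>(1) by (auto simp: t_def min_def)
  have "cmod (1 - of_real t) = 1 - t"
    using t(2) by (metis abs_of_pos diff_gt_0_iff_gt norm_of_real of_real_1 of_real_diff)
  then have z2: "complex_of_real t \<in> U" "cmod (complex_of_real t) < 1"
    using t by (auto simp: U_def dist_norm)
  define A where "A = {y. cmod (?G y (of_real t)) < r / 4}"
  \<comment> \<open>The constant 32 in the hypothesis \<open>small\<close> is what makes Chebyshev's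
    bound equal to 1/2.\<close>
  have "prob {y. r / 4 \<le> cmod (?G y (of_real t))} \<le> (r\<^sup>2 / 32) / (r / 4)\<^sup>2"
    using r order_trans[OF second_moment_tail_series[OF z2(2)] ennreal_leI[OF small]]
    by (intro chebyshev) auto
  also have "\<dots> = 1 / 2" using r by (simp add: power2_eq_square)
  also have "{y. r / 4 \<le> cmod (?G y (of_real t))} = space S - A" by (auto simp: A_def)
  also have "prob \<dots> = 1 - prob A"
  proof (rule P.prob_compl)
    have "{y \<in> space S. cmod (?G y (of_real t)) < r / 4} \<in> sets S" by measurable
    then show "A \<in> sets S" by (simp add: A_def)
  qed
  finally have A: "1 / 2 \<le> prob A" by simp
  have meas: "{y. (\<lambda>n. v j * y n) \<in> {y. comb_seq N x y \<in> hits w r}} \<in> sets S" for j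
    using measurable_sets[OF measurable_rotate sets_comb_seq[OF sets_hits], of "\<lambda>_. v j" N x w r]
    by (simp add: vimage_def)
  have "AE y in S. comb_seq N x y \<in> unbounded_near \<rho>"
    using prob_unbounded_near[OF unb \<rho>(1)] sets_comb_seq[OF sets_unbounded_near]
    by (subst (asm) prob_unbounded_near_comb_seq[of N x, symmetric], subst (asm) P.prob_eq_1) auto
  with AE_bounded_coeffs[of N]
  have "AE y in S. y \<in> A \<longrightarrow> y \<in> (\<Union>j<m. {y. (\<lambda>n. v j * y n) \<in> {y. comb_seq N x y \<in> hits w r}})"
  proof eventually_elim
    case (elim y)
    have split: "F (comb_seq N x y) z = ?P z + ?G y z" if "z \<in> U" for z
      using that U(3) by (intro tail_series_comb_seq[OF elim(1)]) auto
    \<comment> \<open>One \<open>K + 1\<close> pays for subtracting \<open>?P\<close>; the other,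
      with \<open>cmod w\<close>, remains as the lower bound on the tail.\<close>
    obtain Q :: nat where Q: "2 * (K + 1) + cmod w \<le> real Q" using real_arch_simple by blast
    obtain z1 where "z1 \<in> U" "real Q < cmod (F (comb_seq N x y) z1)"
      using elim(2) unfolding unbounded_near_def U_def by blast
    then have z1: "z1 \<in> U" "(K + 1) + cmod w < cmod (?G y z1)"
      using split[of z1] PU[of z1] Q norm_triangle_ineq[of "?P z1" "?G y z1"] by auto
    show ?case
    proof
      assume "y \<in> A"
      then have "\<exists>j<m. \<exists>z\<in>U. cmod (?P z + v j * ?G y z - w) < r"
        unfolding v_def A_def using U(2,3) PU z1 z2(1) m
        by (intro rotation_hits[where L = "K + 1"] continuous_on_partial_series
            continuous_on_subset[OF continuous_on_tail_series[OF elim(1)]]) (auto simp: algebra_simps)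
      then obtain j z where j: "j < m" "z \<in> U" "cmod (?P z + v j * ?G y z - w) < r" by blast
      let ?y = "comb_seq N x (\<lambda>n. v j * y n)"
      have bc: "bounded_coeffs b N (\<lambda>n. v j * y n)"
        by (rule bounded_coeffs_rotate[OF elim(1)]) (simp add: v_def)
      have "F ?y z = ?P z + v j * ?G y z"
        using j(2) U(3) by (subst tail_series_comb_seq[OF bc]) (auto simp: tail_series_mult_left[OF elim(1)])
      then have "\<exists>d\<in>D. d \<in> ball 0 1 \<and> F ?y d \<in> ball w r"
        using j(2,3) U(3)
        by (intro continuous_dense_witness[where z = z] dense_D continuous_on_tail_series
            bounded_coeffs_comb_seq bc) (auto simp: dist_norm norm_minus_commute)
      then have "?y \<in> hits w r"
        by (auto simp: hits_def dist_norm norm_minus_commute)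
      then show "y \<in> (\<Union>j<m. {y. (\<lambda>n. v j * y n) \<in> {y. comb_seq N x y \<in> hits w r}})"
        using j(1) by blast
    qed
  qed
  then have "prob A \<le> prob (\<Union>j<m. {y. (\<lambda>n. v j * y n) \<in> {y. comb_seq N x y \<in> hits w r}})"
    using meas by (intro P.finite_measure_mono_AE) auto
  also have "\<dots> \<le> (\<Sum>j<m. prob {y. (\<lambda>n. v j * y n) \<in> {y. comb_seq N x y \<in> hits w r}})"
    using meas by (intro measure_UNION_le) auto
  also have "\<dots> = (\<Sum>j<m. prob {y. comb_seq N x y \<in> hits w r})"
    by (intro sum.cong refl prob_rotate sets_comb_seq sets_hits) (simp add: v_def)
  finally show ?thesis using A m(1) by (simp add: field_simps)
qed

text \<open>Discard heads of modulus at least \<open>k\<close> at 1. With \<open>m = C * k\<close>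
  rotations the conditional bound gives \<open>p / (2 * C * k) \<le> s / k\<^sup>2\<close> for the
  probability \<open>p\<close> of a miss: \<open>m\<close> grows linearly while Chebyshev's bound
  decays quadratically, so \<open>p = 0\<close> in the limit.\<close>

lemma AE_hits:
  assumes unb: "AE y in S. \<forall>R::nat. \<exists>z\<in>D. z \<in> ball 0 1 \<and> real R < cmod (F y z)"
    and r: "0 < r"
  shows "AE y in S. y \<in> hits w r"
proof -
  define E where "E = space S - hits w r"
  have E: "E \<in> sets S" unfolding E_def by (intro sets.compl_sets sets_hits)
  define s where "s = (\<Sum>n. (b n)\<^sup>2)"
  have s: "0 \<le> s" unfolding s_def by (intro suminf_nonneg summable_b) auto
  have "(\<lambda>N. \<Sum>n. (b (n + N))\<^sup>2) \<longlonglongrightarrow> 0"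
    using suminf_exist_split2[OF summable_b] .
  then have "\<forall>\<^sub>F N in sequentially. (\<Sum>n. (b (n + N))\<^sup>2) < r\<^sup>2 / 32"
    using r by (intro order_tendstoD(2)) auto
  then obtain N0 where N0: "\<And>N. N \<ge> N0 \<Longrightarrow> (\<Sum>n. (b (n + N))\<^sup>2) \<le> r\<^sup>2 / 32"
    by (auto simp: eventually_sequentially intro: less_imp_le)
  \<comment> \<open>Since \<open>k + 1 + cmod w\<close> is at most \<open>(2 + cmod w) * k\<close>
    for \<open>k \<ge> 1\<close>, this one constant lets \<open>m = C * k\<close> meet the
    requirement on \<open>m\<close> for all such \<open>k\<close>.\<close>
  obtain C :: nat where C: "2 * pi * (2 + cmod w) / r < real C" using reals_Archimedean2 by blast
  have "0 < 2 * pi * (2 + cmod w) / r"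
    using r by (intro divide_pos_pos mult_pos_pos add_pos_nonneg) auto
  then have "0 < real C" using C by linarith
  then have C0: "0 < C" by simp
  have bound: "prob E \<le> (2 * real C * s) / real k" if k: "0 < k" for k :: nat
  proof -
    define m where "m = C * k"
    have m: "0 < m" using C0 k by (simp add: m_def)
    have "(1 + cmod w) * 1 \<le> (1 + cmod w) * real k"
      using k by (intro mult_left_mono) auto
    then have "real k + 1 + cmod w \<le> (2 + cmod w) * real k"
      by (simp add: algebra_simps)
    then have "2 * pi * (real k + 1 + cmod w) \<le> 2 * pi * ((2 + cmod w) * real k)"
      by (intro mult_left_mono) auto
    also have "\<dots> = 2 * pi * (2 + cmod w) * real k" by simp
    also have "\<dots> < r * real C * real k"
      using C r k by (intro mult_strict_right_mono) (simp_all add: pos_divide_less_eq mult.commute)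
    also have "\<dots> = r * real m" by (simp add: m_def)
    finally have m': "2 * pi * (real k + 1 + cmod w) < r * real m" .
    \<comment> \<open>The second moment of the head at 1 is at most \<open>s\<close> for every
      \<open>N\<close>, so the exceptional sets are small uniformly in \<open>N\<close>.\<close>
    define X where "X N = {x. real k \<le> cmod (partial_series b N x 1)}" for N
    have "prob E \<le> (1 - 1 / (2 * real m)) * prob E + s / (real k)\<^sup>2"
    proof (rule prob_le_conditional_bound[OF E, where X = X and ?N0.0 = N0])
      fix N assume N: "N \<ge> N0"
      have "{x \<in> space S. real k \<le> cmod (partial_series b N x 1)} \<in> sets S" by measurable
      then show "X N \<in> sets S" by (simp add: X_def)
      have "(\<integral>\<^sup>+x. ennreal ((cmod (partial_series b N x 1))\<^sup>2) \<partial>S) = ennreal (\<Sum>n<N. (b n)\<^sup>2)"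
        using second_moment_sum[where k = N and c = "\<lambda>n. complex_of_real (b n)"] by (simp add: partial_series_def)
      also have "\<dots> \<le> ennreal s"
        unfolding s_def by (intro ennreal_leI sum_le_suminf summable_b) auto
      finally show "prob (X N) \<le> s / (real k)\<^sup>2"
        unfolding X_def using k s by (intro chebyshev) auto
      fix x assume "x \<in> space S - X N"
      then have "1 / (2 * real m) \<le> prob {y. comb_seq N x y \<in> hits w r}"
        using m m' by (intro prob_hits_comb_seq[OF unb r N0[OF N], where K = "real k"]) (auto simp: X_def)
      also have "\<dots> = 1 - prob (space S - {y. comb_seq N x y \<in> hits w r})"
        using P.prob_compl[OF sets_comb_seq[OF sets_hits]] by simp
      also have "space S - {y. comb_seq N x y \<in> hits w r} = {y \<in> space S. comb_seq N x y \<in> E}"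
        by (auto simp: E_def)
      finally show "prob {y \<in> space S. comb_seq N x y \<in> E} \<le> 1 - 1 / (2 * real m)" by simp
    qed (use m in auto)
    then have "prob E / (2 * real m) \<le> s / (real k)\<^sup>2" by (simp add: algebra_simps)
    then show ?thesis using C0 k by (simp add: m_def field_simps power2_eq_square)
  qed
  have "prob E \<le> 0 + e" if e: "0 < e" for e
  proof -
    obtain k :: nat where k: "2 * real C * s / e < real k" using reals_Archimedean2 by blast
    have "0 \<le> 2 * real C * s / e" using s e by simp
    then have k0: "0 < k" using k by (cases k) auto
    have "2 * real C * s / real k \<le> e" using k k0 e by (simp add: field_simps)
    then show ?thesis using bound[OF k0] by simp
  qed
  then have "prob E \<le> 0" by (rule field_le_epsilon)
  then have "prob E = 0" using measure_nonneg[of S E] by linarith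
  then show ?thesis
    using E by (intro AE_I[of _ _ E]) (auto simp: P.emeasure_eq_measure E_def)
qed

text \<open>Countably many discs, with centres in \<open>D\<close> and radii
  \<open>1 / (k + 1)\<close>, suffice for density, so the null sets can be united.\<close>

lemma AE_image_dense:
  assumes unb: "AE y in S. \<forall>R::nat. \<exists>z\<in>D. z \<in> ball 0 1 \<and> real R < cmod (F y z)"
  shows "AE y in S. closure (F y ` ball 0 1) = UNIV"
proof -
  have "AE y in S. \<forall>w\<in>D. \<forall>k::nat. y \<in> hits w (1 / real (Suc k))"
    by (subst AE_ball_countable[OF countable_D]) (simp add: AE_all_countable AE_hits[OF unb])
  then show ?thesis
  proof eventually_elim
    case (elim y)
    have "w \<in> closure (F y ` ball 0 1)" for w
      unfolding closure_approachable
    proof (intro allI impI)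
      fix e :: real assume e: "0 < e"
      obtain w' where w': "w' \<in> D" "w' \<in> ball w (e / 2)"
        using dense_D[of "ball w (e / 2)"] e by auto
      obtain k where k: "1 / real (Suc k) < e / 2"
        using e nat_approx_posE[of "e / 2"] by auto
      have "y \<in> hits w' (1 / real (Suc k))" using elim w'(1) by blast
      then obtain z where z: "z \<in> ball 0 1" "cmod (F y z - w') < 1 / real (Suc k)"
        unfolding hits_def by blast
      have "dist (F y z) w \<le> dist (F y z) w' + dist w' w" by (rule dist_triangle)
      also have "\<dots> < e" using z(2) k w'(2) by (simp add: dist_norm norm_minus_commute)
      finally show "\<exists>v\<in>F y ` ball 0 1. dist v w < e" using z(1) by blast
    qed
    then show ?case by blast
  qed
qed

end

section \<open>Density of the image\<close>

theorem theorem1p1: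
  fixes M :: "'w measure"
    and \<zeta> :: "nat \<Rightarrow> 'w \<Rightarrow> complex"
    and a :: "nat \<Rightarrow> real"
  assumes "prob_space M"
    and "prob_space.indep_vars M (\<lambda>_. borel) \<zeta> {1..}"
    and "\<And>m n. m \<ge> 1 \<Longrightarrow> n \<ge> 1 \<Longrightarrow> distr M borel (\<zeta> m) = distr M borel (\<zeta> n)"
    and "\<And>n. n \<ge> 1 \<Longrightarrow> rotationally_invariant M (\<zeta> n)"
    and "\<And>n. n \<ge> 1 \<Longrightarrow> prob_space.expectation M (\<lambda>\<omega>. (cmod (\<zeta> n \<omega>))\<^sup>2) = 1"
    and "\<And>n. n \<ge> 1 \<Longrightarrow> a n \<ge> 0"
    and "summable (\<lambda>n. (a (Suc n))\<^sup>2)"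
    and "limsup (\<lambda>n. ereal (root n (a n))) = 1"
    and "AE \<omega> in M. \<not> bounded (random_power_series \<zeta> a \<omega> ` ball 0 1)"
  shows "AE \<omega> in M. closure (random_power_series \<zeta> a \<omega> ` ball 0 1) = UNIV"
proof -
  interpret Q: prob_space M by fact
  define b where "b n = a (Suc n)" for n
  define X where "X \<omega> n = \<zeta> (Suc n) \<omega>" for \<omega> n
  define \<mu> where "\<mu> = distr M borel (\<zeta> 1)"
  have rv [measurable]: "\<zeta> n \<in> borel_measurable M" if "n \<ge> 1" for n
    using assms(4)[OF that] by (simp add: rotationally_invariant_def)
  have rv' [measurable]: "(\<lambda>\<omega>. X \<omega> n) \<in> borel_measurable M" for n
    unfolding X_def by (rule rv) simp
  have X [measurable]: "X \<in> measurable M (\<Pi>\<^sub>M i\<in>UNIV. borel)"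
    by (rule measurable_PiM_single') (auto intro: rv')
  have law: "distr M (\<Pi>\<^sub>M i\<in>UNIV. borel) X = (\<Pi>\<^sub>M i\<in>UNIV. \<mu>)"
  proof -
    define Z where "Z \<omega> = (\<lambda>n\<in>{1..}. \<zeta> n \<omega>)" for \<omega>
    \<comment> \<open>The \<open>max\<close> makes \<open>N n\<close> the law of some
      \<open>\<zeta> i\<close> with \<open>i \<ge> 1\<close> at index 0 too, so that
      \<open>N\<close> is a family of probability measures equal to \<open>\<mu>\<close>.\<close>
    define N where "N n = distr M borel (\<zeta> (max 1 n))" for n
    define shift :: "(nat \<Rightarrow> complex) \<Rightarrow> nat \<Rightarrow> complex" where "shift y = (\<lambda>n\<in>UNIV. y (Suc n))" for y
    have N: "N n = \<mu>" for n
      unfolding N_def \<mu>_def by (rule assms(3)) auto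
    have Z: "Z \<in> measurable M (\<Pi>\<^sub>M i\<in>{1..}. borel)"
      unfolding Z_def by (rule measurable_restrict) (auto intro: rv)
    have shift: "shift \<in> measurable (\<Pi>\<^sub>M i\<in>{1..}. borel) (\<Pi>\<^sub>M i\<in>UNIV. borel)"
      unfolding shift_def by (intro measurable_restrict measurable_component_singleton) simp
    have "distr M (\<Pi>\<^sub>M i\<in>{1..}. borel) Z = (\<Pi>\<^sub>M i\<in>{1..}. distr M borel (\<zeta> i))"
      using assms(2) rv unfolding Z_def by (subst (asm) Q.indep_vars_iff_distr_eq_PiM') auto
    also have "\<dots> = (\<Pi>\<^sub>M i\<in>{1..}. N i)"
      by (intro PiM_cong) (auto simp: N_def max_def)
    finally have Z_law: "distr M (\<Pi>\<^sub>M i\<in>{1..}. borel) Z = (\<Pi>\<^sub>M i\<in>{1..}. N i)" .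
    have "distr M (\<Pi>\<^sub>M i\<in>UNIV. borel) X = distr M (\<Pi>\<^sub>M i\<in>UNIV. borel) (shift \<circ> Z)"
      by (intro distr_cong) (auto simp: shift_def Z_def X_def fun_eq_iff)
    also have "\<dots> = distr (\<Pi>\<^sub>M i\<in>{1..}. N i) (\<Pi>\<^sub>M i\<in>UNIV. borel) shift"
      unfolding Z_law[symmetric] by (rule distr_distr[OF shift Z, symmetric])
    \<comment> \<open>Only the target sigma-algebra matters for \<open>distr\<close>, so it can be
      renamed to fit the reindexing of a product measure along \<open>Suc\<close>.\<close>
    also have "\<dots> = distr (\<Pi>\<^sub>M i\<in>{1..}. N i) (\<Pi>\<^sub>M i\<in>UNIV. N (Suc i)) shift"
      by (intro distr_cong sets_PiM_cong) (auto simp: N_def)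
    also have "\<dots> = (\<Pi>\<^sub>M i\<in>UNIV. N (Suc i))"
      unfolding shift_def
      by (rule distr_PiM_reindex) (auto simp: N_def intro!: Q.prob_space_distr rv)
    finally show ?thesis by (simp only: N)
  qed
  obtain D :: "complex set" where D: "countable D" "\<And>Y. open Y \<Longrightarrow> Y \<noteq> {} \<Longrightarrow> \<exists>d\<in>D. d \<in> Y"
    using countable_dense_exists by blast
  interpret rotation_invariant_sequence \<mu> b D
  proof (intro rotation_invariant_sequence.intro rotation_invariant_sequence_axioms.intro
      sequence_space.intro product_prob_spaceI)
    show "prob_space \<mu>"
      unfolding \<mu>_def by (rule Q.prob_space_distr) (rule rv, simp)
    show sets: "sets \<mu> = sets borel" by (simp add: \<mu>_def)
    show "distr \<mu> \<mu> ((*) u) = \<mu>" if u: "cmod u = 1" for u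
    proof -
      obtain t where t: "t \<in> {0..2 * pi}" "u = exp (\<i> * of_real t)"
        using Arg2pi_eq[of u] Arg2pi_ge_0[of u] Arg2pi_lt_2pi[of u] u by force
      have "distr \<mu> \<mu> ((*) u) = distr \<mu> borel ((*) u)"
        by (rule distr_cong) (simp_all add: sets)
      also have "\<dots> = distr M borel ((*) u \<circ> \<zeta> 1)"
        unfolding \<mu>_def by (rule distr_distr) (auto intro: rv)
      also have "\<dots> = \<mu>"
        using assms(4)[of 1] t unfolding rotationally_invariant_def \<mu>_def comp_def by auto
      finally show ?thesis .
    qed
    have E: "Q.expectation (\<lambda>\<omega>. (cmod (\<zeta> 1 \<omega>))\<^sup>2) = 1" using assms(5) by simp
    \<comment> \<open>The integral of a non-integrable function is 0 by convention, so the value 1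
      forces integrability.\<close>
    then have "integrable M (\<lambda>\<omega>. (cmod (\<zeta> 1 \<omega>))\<^sup>2)"
      using not_integrable_integral_eq by fastforce
    then have "(\<integral>\<^sup>+\<omega>. ennreal ((cmod (\<zeta> 1 \<omega>))\<^sup>2) \<partial>M) = 1"
      using E by (subst nn_integral_eq_integral) auto
    moreover have "(\<integral>\<^sup>+x. ennreal ((cmod x)\<^sup>2) \<partial>\<mu>) = (\<integral>\<^sup>+\<omega>. ennreal ((cmod (\<zeta> 1 \<omega>))\<^sup>2) \<partial>M)"
      unfolding \<mu>_def using rv[of 1] by (intro nn_integral_distr) auto
    ultimately show "(\<integral>\<^sup>+x. ennreal ((cmod x)\<^sup>2) \<partial>\<mu>) = 1" by simp
    show "summable (\<lambda>n. (b n)\<^sup>2)" using assms(7) by (simp add: b_def)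
    show "countable D" by (rule D(1))
    show "\<exists>d\<in>D. d \<in> Y" if "open Y" "Y \<noteq> {}" for Y by (rule D(2)[OF that])
  qed
  have F: "random_power_series \<zeta> a \<omega> = F (X \<omega>)" for \<omega>
    by (simp add: fun_eq_iff random_power_series_def tail_series_def X_def b_def)
  have "AE \<omega> in M. bounded_coeffs b 0 (X \<omega>)"
    by (rule AE_distrD[OF X]) (simp only: law AE_bounded_coeffs)
  with assms(9) have "AE \<omega> in M. \<forall>R::nat. \<exists>z\<in>D. z \<in> ball 0 1 \<and> real R < cmod (F (X \<omega>) z)"
  proof eventually_elim
    case (elim \<omega>)
    show ?case
    proof
      fix R :: nat
      obtain z where z: "z \<in> ball 0 1" "real R < cmod (F (X \<omega>) z)"
        using elim(1) unfolding F bounded_iff by (force simp: not_le)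
      have "\<exists>d\<in>D. d \<in> ball 0 1 \<and> F (X \<omega>) d \<in> - cball 0 (real R)"
        using z by (intro continuous_dense_witness[where z = z] continuous_on_tail_series elim(2) dense_D) auto
      then show "\<exists>z\<in>D. z \<in> ball 0 1 \<and> real R < cmod (F (X \<omega>) z)" by auto
    qed
  qed
  \<comment> \<open>Measurability of the event is what allows an almost sure statement on
    \<open>M\<close> to pass to the law of \<open>X\<close>; the return at the end needs only
    \<open>AE_distrD\<close>.\<close>
  moreover have "{y \<in> space (\<Pi>\<^sub>M i\<in>UNIV. borel). \<forall>R::nat. \<exists>z\<in>D. z \<in> ball 0 1 \<and> real R < cmod (F y z)}
      \<in> sets (\<Pi>\<^sub>M i\<in>UNIV. borel)"
  proof -
    have "{y \<in> space S. \<forall>R::nat. \<exists>z\<in>D. z \<in> ball 0 1 \<and> real R < cmod (F y z)} \<in> sets S"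
      by measurable
    also have "sets S = sets (\<Pi>\<^sub>M i\<in>UNIV. borel)" by (intro sets_PiM_cong) auto
    finally show ?thesis by (simp add: space_PiM)
  qed
  ultimately have "AE y in S. \<forall>R::nat. \<exists>z\<in>D. z \<in> ball 0 1 \<and> real R < cmod (F y z)"
    unfolding law[symmetric] by (subst AE_distr_iff[OF X])
  then have "AE y in S. closure (F y ` ball 0 1) = UNIV"
    by (rule AE_image_dense)
  then have "AE \<omega> in M. closure (F (X \<omega>) ` ball 0 1) = UNIV"
    by (intro AE_distrD[OF X]) (simp only: law)
  then show ?thesis by (simp only: F)
qed

end
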